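(* Let $\mathcal K\subseteq\mathbb R^{\tilde n}$ and let $\mathcal L=(\mathcal K,\mathbb N_N,\{l_n\}_{n\in\mathbb N_N})$ be a PCF self-similar structure equipped with a harmonic structure. Let $V_0=\{p_1,\dots,p_L\}$ and $V_1=\{t_1,\dots,t_M\}$ with $t_k=p_k$ for $1\le k\le L$. Let $\mathcal J\subset\mathbb R$ be compact and let $u:V_1\to\mathbb R$ be a given function with values in $\mathcal J$. For each $n\in\mathbb N_N$ let $h_n:\mathcal K\to\mathbb R$ be a nonconstant harmonic function, let $s_n:\mathcal J\to\mathcal J$ be an Edelstein contraction, and suppose that $F_n(x,y)=h_n(x)+s_n(y)$ defines a (continuous) map $F_n:\mathcal K\times\mathcal J\to\mathcal J$ satisfying $$h_n(p_k)+s_n(u(p_k))=u(l_n(p_k))\qquad\text{for all } n\in\mathbb N_N,\ 1\le k\le L.$$ Let $W_n:\mathcal K\times\mathcal J\to\mathcal K\times\mathcal J$ be given by $W_n(x,y)=(l_n(x),F_n(x,y))$. Then there exists a unique continuous function $f^*:\mathcal K\to\mathcal J$ which satisfies $f^*(t_j)=u(t_j)$ for all $1\le j\le M$ and whose graph is an invariant set of the IFS $\{\mathcal K\times\mathcal J;\,W_n,\ n\in\mathbb N_N\}$. In particular, $f^*|_{V_1}=u$ and $$f^*(l_n(x))=s_n(f^*(x))+h_n(x)\qquad\text{for all } n\in\mathbb N_N,\ x\in\mathcal K.$$ Moreover, if $\Gamma f^*|_{\mathcal K}=\{(x,f^*(x)):x\in\mathcal K\}$ is the graph of $f^*$ on $\mathcal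 K$, then $$\Gamma f^*|_{\mathcal K}=\bigcup_{n\in\mathbb N_N}W_n\big(\Gamma f^*|_{\mathcal K}\big).$$
   Context: $\mathbb N_N=\{1,\dots,N\}$. Self-similar structure: $\mathcal K$ is a compact metrizable space, each $l_i:\mathcal K\to\mathcal K$ ($i\in\mathbb N_N$) is a continuous injection, and there is a continuous surjection $\pi:\Sigma\to\mathcal K$, $\Sigma=\mathbb N_N^{\mathbb N}$, with $l_i\circ\pi=\pi\circ\sigma_i$, where $\sigma_i(w_1w_2\ldots)=iw_1w_2\ldots$. In particular $\mathcal K=\bigcup_{n}l_n(\mathcal K)$. Let $\sigma(w_1w_2w_3\ldots)=w_2w_3\ldots$. The critical set is $\mathcal C=\pi^{-1}\big(\bigcup_{i\ne j}(l_i(\mathcal K)\cap l_j(\mathcal K))\big)$, the post-critical set is $\mathcal P=\bigcup_{n\ge1}\sigma^n(\mathcal C)$, and $V_0=\pi(\mathcal P)$. The structure is post-critically finite (PCF) if $\mathcal P$ is finite. For a word $w=w_1\cdots w_m\in\mathbb N_N^m$, $l_w=l_{w_1}\circ\cdots\circ l_{w_m}$; $V_m=\bigcup_{w\in\mathbb N_N^m}l_w(V_0)$; one has $V_m\subset V_{m+1}$ and $V_*=\bigcup_m V_m$ is dense in $\mathcal K$. Harmonic structure: a Laplace matrix on $V_0$ is a symmetric matrix $H$ with $H_{pq}\ge0$ for $p\ne q$, $(f,Hf):=\sum_{p}f(p)\sum_qH_{pq}f(q)\le0$ for all $f:V_0\to\mathbb R$, and $Hf=0$ iff $f$ is constant.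 Given $H$ and positive numbers $\mathbf r=\{r_i\}_{i\in\mathbb N_N}$, put $r_w=r_{w_1}\cdots r_{w_m}$, $\mathcal E_0(f)=-(f,Hf)$ and $\mathcal E_m(f)=\sum_{w\in\mathbb N_N^m}r_w^{-1}\mathcal E_0(f\circ l_w|_{V_0})$. $(H,\mathbf r)$ is a harmonic structure if $\min\{\mathcal E_1(g):g:V_1\to\mathbb R,\ g|_{V_0}=f\}=\mathcal E_0(f)$ for all $f:V_0\to\mathbb R$. A harmonic function with boundary values $f:V_0\to\mathbb R$ is the continuous function $h:\mathcal K\to\mathbb R$ with $h|_{V_0}=f$ such that, for each $m\ge1$, $h|_{V_m}$ minimizes $\mathcal E_m$ among functions on $V_m$ that equal $f$ on $V_0$. An Edelstein contraction on a metric space $(X,d)$ is a map $g:X\to X$ with $d(g(x),g(y))<d(x,y)$ whenever $x\ne y$. A set $A\subset\mathcal K\times\mathcal J$ is an invariant set of the IFS $\{W_n\}$ if $A=\bigcup_nW_n(A)$. *)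

theory Defs
  imports "HOL-Analysis.Analysis"
begin

text \<open>
  An infinite word \<open>w\<^sub>1w\<^sub>2w\<^sub>3\<dots>\<close> over \<open>{1..N}\<close> is a function \<open>w :: nat \<Rightarrow> nat\<close> whose positions
  are counted from 0, so \<open>w k\<close> is the letter \<open>w\<^bsub>k+1\<^esub>\<close>. The type \<open>nat \<Rightarrow> nat\<close> carries the product
  topology of discrete spaces, and the code space inherits it as a subspace.
\<close>

definition code_space :: "nat \<Rightarrow> (nat \<Rightarrow> nat) set" where
  "code_space N = {w. \<forall>k. w k \<in> {1..N}}"

definition prepend :: "nat \<Rightarrow> (nat \<Rightarrow> nat) \<Rightarrow> (nat \<Rightarrow> nat)" where
  "prepend i w = (\<lambda>k. case k of 0 \<Rightarrow> i | Suc j \<Rightarrow> w j)"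

definition shift :: "(nat \<Rightarrow> nat) \<Rightarrow> (nat \<Rightarrow> nat)" where
  "shift w = (\<lambda>k. w (Suc k))"

text \<open>
  The coding map \<open>\<pi>\<close> is an explicit parameter. It is determined by the maps \<open>l\<close>, so
  assuming the predicate below for some \<open>\<pi>\<close> amounts to assuming that a coding map exists.
\<close>

definition self_similar_structure ::
    "'a::metric_space set \<Rightarrow> nat \<Rightarrow> (nat \<Rightarrow> 'a \<Rightarrow> 'a) \<Rightarrow> ((nat \<Rightarrow> nat) \<Rightarrow> 'a) \<Rightarrow> bool" where
  "self_similar_structure K N l \<pi> \<longleftrightarrow>
     compact K \<and>
     (\<forall>i\<in>{1..N}. l i \<in> K \<rightarrow> K \<and> continuous_on K (l i) \<and> inj_on (l i) K) \<and>
     continuous_on (code_space N) \<pi> \<and> \<pi> ` code_space N = K \<and>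
     (\<forall>i\<in>{1..N}. \<forall>w\<in>code_space N. l i (\<pi> w) = \<pi> (prepend i w))"

definition critical_set ::
    "'a set \<Rightarrow> nat \<Rightarrow> (nat \<Rightarrow> 'a \<Rightarrow> 'a) \<Rightarrow> ((nat \<Rightarrow> nat) \<Rightarrow> 'a) \<Rightarrow> (nat \<Rightarrow> nat) set" where
  "critical_set K N l \<pi> =
     {w \<in> code_space N. \<exists>i\<in>{1..N}. \<exists>j\<in>{1..N}. i \<noteq> j \<and> \<pi> w \<in> l i ` K \<inter> l j ` K}"

definition post_critical_set ::
    "'a set \<Rightarrow> nat \<Rightarrow> (nat \<Rightarrow> 'a \<Rightarrow> 'a) \<Rightarrow> ((nat \<Rightarrow> nat) \<Rightarrow> 'a) \<Rightarrow> (nat \<Rightarrow> nat) set" where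
  "post_critical_set K N l \<pi> = (\<Union>n\<in>{1..}. (shift ^^ n) ` critical_set K N l \<pi>)"

definition pcf_self_similar_structure ::
    "'a::metric_space set \<Rightarrow> nat \<Rightarrow> (nat \<Rightarrow> 'a \<Rightarrow> 'a) \<Rightarrow> ((nat \<Rightarrow> nat) \<Rightarrow> 'a) \<Rightarrow> bool" where
  "pcf_self_similar_structure K N l \<pi> \<longleftrightarrow>
     self_similar_structure K N l \<pi> \<and> finite (post_critical_set K N l \<pi>)"

definition V0 :: "'a set \<Rightarrow> nat \<Rightarrow> (nat \<Rightarrow> 'a \<Rightarrow> 'a) \<Rightarrow> ((nat \<Rightarrow> nat) \<Rightarrow> 'a) \<Rightarrow> 'a set" where
  "V0 K N l \<pi> = \<pi> ` post_critical_set K N l \<pi>"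

definition words :: "nat \<Rightarrow> nat \<Rightarrow> nat list set" where
  "words N m = {w. length w = m \<and> set w \<subseteq> {1..N}}"

definition word_map :: "(nat \<Rightarrow> 'a \<Rightarrow> 'a) \<Rightarrow> nat list \<Rightarrow> 'a \<Rightarrow> 'a" where
  "word_map l w = foldr (\<lambda>i g. l i \<circ> g) w id"

definition V ::
    "'a set \<Rightarrow> nat \<Rightarrow> (nat \<Rightarrow> 'a \<Rightarrow> 'a) \<Rightarrow> ((nat \<Rightarrow> nat) \<Rightarrow> 'a) \<Rightarrow> nat \<Rightarrow> 'a set" where
  "V K N l \<pi> m = (\<Union>w\<in>words N m. word_map l w ` V0 K N l \<pi>)"

text \<open>
  Functions on a finite set \<open>B\<close> of points, and matrices indexed by it, are represented by total
  functions; the definitions below only use their values on \<open>B\<close>.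
\<close>

definition laplace_matrix :: "'a set \<Rightarrow> ('a \<Rightarrow> 'a \<Rightarrow> real) \<Rightarrow> bool" where
  "laplace_matrix B H \<longleftrightarrow>
     (\<forall>p\<in>B. \<forall>q\<in>B. H p q = H q p) \<and>
     (\<forall>p\<in>B. \<forall>q\<in>B. p \<noteq> q \<longrightarrow> H p q \<ge> 0) \<and>
     (\<forall>f. (\<Sum>p\<in>B. f p * (\<Sum>q\<in>B. H p q * f q)) \<le> 0) \<and>
     (\<forall>f. (\<forall>p\<in>B. (\<Sum>q\<in>B. H p q * f q) = 0) \<longleftrightarrow> f constant_on B)"

definition energy0 :: "'a set \<Rightarrow> ('a \<Rightarrow> 'a \<Rightarrow> real) \<Rightarrow> ('a \<Rightarrow> real) \<Rightarrow> real" where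
  "energy0 B H f = - (\<Sum>p\<in>B. f p * (\<Sum>q\<in>B. H p q * f q))"

definition energy ::
    "'a set \<Rightarrow> nat \<Rightarrow> (nat \<Rightarrow> 'a \<Rightarrow> 'a) \<Rightarrow> ((nat \<Rightarrow> nat) \<Rightarrow> 'a) \<Rightarrow>
     ('a \<Rightarrow> 'a \<Rightarrow> real) \<Rightarrow> (nat \<Rightarrow> real) \<Rightarrow> nat \<Rightarrow> ('a \<Rightarrow> real) \<Rightarrow> real" where
  "energy K N l \<pi> H r m f =
     (\<Sum>w\<in>words N m. inverse (prod_list (map r w)) * energy0 (V0 K N l \<pi>) H (f \<circ> word_map l w))"

text \<open>
  The last two conjuncts say that \<open>energy0 f\<close> is the minimum of the level-1 energies of the
  extensions of \<open>f\<close>: it is attained, and it is a lower bound.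
\<close>

definition harmonic_structure ::
    "'a set \<Rightarrow> nat \<Rightarrow> (nat \<Rightarrow> 'a \<Rightarrow> 'a) \<Rightarrow> ((nat \<Rightarrow> nat) \<Rightarrow> 'a) \<Rightarrow>
     ('a \<Rightarrow> 'a \<Rightarrow> real) \<Rightarrow> (nat \<Rightarrow> real) \<Rightarrow> bool" where
  "harmonic_structure K N l \<pi> H r \<longleftrightarrow>
     laplace_matrix (V0 K N l \<pi>) H \<and> (\<forall>i\<in>{1..N}. r i > 0) \<and>
     (\<forall>f. (\<exists>g. (\<forall>p\<in>V0 K N l \<pi>. g p = f p) \<and>
               energy K N l \<pi> H r 1 g = energy0 (V0 K N l \<pi>) H f) \<and>
          (\<forall>g. (\<forall>p\<in>V0 K N l \<pi>. g p = f p) \<longrightarrow>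
               energy0 (V0 K N l \<pi>) H f \<le> energy K N l \<pi> H r 1 g))"

definition harmonic_with_boundary ::
    "'a::metric_space set \<Rightarrow> nat \<Rightarrow> (nat \<Rightarrow> 'a \<Rightarrow> 'a) \<Rightarrow> ((nat \<Rightarrow> nat) \<Rightarrow> 'a) \<Rightarrow>
     ('a \<Rightarrow> 'a \<Rightarrow> real) \<Rightarrow> (nat \<Rightarrow> real) \<Rightarrow> ('a \<Rightarrow> real) \<Rightarrow> ('a \<Rightarrow> real) \<Rightarrow> bool" where
  "harmonic_with_boundary K N l \<pi> H r f h \<longleftrightarrow>
     continuous_on K h \<and> (\<forall>p\<in>V0 K N l \<pi>. h p = f p) \<and>
     (\<forall>m\<ge>1. \<forall>g. (\<forall>p\<in>V0 K N l \<pi>. g p = f p) \<longrightarrow>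
        energy K N l \<pi> H r m h \<le> energy K N l \<pi> H r m g)"

definition harmonic_function ::
    "'a::metric_space set \<Rightarrow> nat \<Rightarrow> (nat \<Rightarrow> 'a \<Rightarrow> 'a) \<Rightarrow> ((nat \<Rightarrow> nat) \<Rightarrow> 'a) \<Rightarrow>
     ('a \<Rightarrow> 'a \<Rightarrow> real) \<Rightarrow> (nat \<Rightarrow> real) \<Rightarrow> ('a \<Rightarrow> real) \<Rightarrow> bool" where
  "harmonic_function K N l \<pi> H r h \<longleftrightarrow> (\<exists>f. harmonic_with_boundary K N l \<pi> H r f h)"

definition edelstein_contraction :: "'a::metric_space set \<Rightarrow> ('a \<Rightarrow> 'a) \<Rightarrow> bool" where
  "edelstein_contraction X g \<longleftrightarrow>
     g \<in> X \<rightarrow> X \<and> (\<forall>x\<in>X. \<forall>y\<in>X. x \<noteq> y \<longrightarrow> dist (g x) (g y) < dist x y)"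

definition ifs_invariant :: "'b set \<Rightarrow> nat \<Rightarrow> (nat \<Rightarrow> 'b \<Rightarrow> 'b) \<Rightarrow> 'b set \<Rightarrow> bool" where
  "ifs_invariant X N W A \<longleftrightarrow> A \<subseteq> X \<and> A = (\<Union>n\<in>{1..N}. W n ` A)"

definition graph_on :: "'a set \<Rightarrow> ('a \<Rightarrow> 'b) \<Rightarrow> ('a \<times> 'b) set" where
  "graph_on K f = {(x, f x) | x. x \<in> K}"

end

theory Submission
  imports Defs
begin

text \<open>
  Start from \<open>K \<times> J\<close> and apply the Hutchinson operator \<open>A \<mapsto> \<Union>\<^sub>n W\<^sub>n(A)\<close> repeatedly. The
  intersection \<open>A\<close> of the resulting decreasing sequence is the largest invariant set, it is compact,
  and it projects onto \<open>K\<close>. It is the graph of the required function: a point of maximal vertical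
  deviation in \<open>A\<close> comes from a point of strictly larger deviation, because the \<open>s\<^sub>n\<close> are Edelstein
  contractions. Applied over \<open>V\<^sub>0\<close>, whose preimages under the \<open>l\<^sub>n\<close> stay in \<open>V\<^sub>0\<close>, this shows that the
  fibres there are the points prescribed by \<open>u\<close>. Applied over \<open>K\<close> it shows that all fibres are
  singletons, as different cells meet only in images of \<open>V\<^sub>0\<close>. Uniqueness is the maximality of \<open>A\<close>.
\<close>

section \<open>Shifts of codes and post-critical codes\<close>

lemma shift_prepend [simp]: "shift (prepend i w) = w"
  by (simp add: shift_def prepend_def)

lemma prepend_shift [simp]: "prepend (w 0) (shift w) = w"
  by (auto simp: shift_def prepend_def fun_eq_iff split: nat.split)

lemma prepend_in_code_space: "i \<in> {1..N} \<Longrightarrow> w \<in> code_space N \<Longrightarrow> prepend i w \<in> code_space N"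
  by (auto simp: code_space_def prepend_def split: nat.split)

lemma shift_in_code_space: "w \<in> code_space N \<Longrightarrow> shift w \<in> code_space N"
  unfolding code_space_def shift_def by blast

lemma post_critical_set_subset_code_space: "post_critical_set K N l \<pi> \<subseteq> code_space N"
proof -
  have "(shift ^^ n) w \<in> code_space N" if "w \<in> code_space N" for n w
    using that by (induction n) (auto intro: shift_in_code_space)
  then show ?thesis
    unfolding post_critical_set_def critical_set_def by blast
qed

lemma shift_in_post_critical_set:
  assumes "w \<in> post_critical_set K N l \<pi>"
  shows "shift w \<in> post_critical_set K N l \<pi>"
proof -
  from assms obtain n v where v: "v \<in> critical_set K N l \<pi>" and w: "w = (shift ^^ n) v"
    unfolding post_critical_set_def by blast
  then have "shift w = (shift ^^ Suc n) v" by simp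
  with v show ?thesis
    unfolding post_critical_set_def by (intro UN_I[of "Suc n"] image_eqI) auto
qed

lemma V_1: "V K N l \<pi> 1 = (\<Union>i\<in>{1..N}. l i ` V0 K N l \<pi>)"
proof -
  have "words N 1 = (\<lambda>i. [i]) ` {1..N}"
    by (auto simp: words_def length_Suc_conv)
  then show ?thesis
    by (simp add: V_def word_map_def)
qed

section \<open>Cells and boundary points\<close>

context
  fixes K :: "'a::metric_space set" and N :: nat and l :: "nat \<Rightarrow> 'a \<Rightarrow> 'a"
    and \<pi> :: "(nat \<Rightarrow> nat) \<Rightarrow> 'a"
  assumes sss: "self_similar_structure K N l \<pi>"
begin

lemma l_in: "i \<in> {1..N} \<Longrightarrow> x \<in> K \<Longrightarrow> l i x \<in> K"
  using sss by (simp add: self_similar_structure_def Pi_iff)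

lemma coding_in: "w \<in> code_space N \<Longrightarrow> \<pi> w \<in> K"
  using sss by (auto simp only: self_similar_structure_def)

lemma coding_E:
  assumes "x \<in> K"
  obtains w where "w \<in> code_space N" "x = \<pi> w"
proof -
  have "x \<in> \<pi> ` code_space N" using sss assms by (simp add: self_similar_structure_def)
  then show ?thesis using that by (rule imageE)
qed

lemma coding_prepend: "i \<in> {1..N} \<Longrightarrow> w \<in> code_space N \<Longrightarrow> \<pi> (prepend i w) = l i (\<pi> w)"
  using sss by (simp add: self_similar_structure_def)

lemma coding_shift:
  assumes "w \<in> code_space N"
  shows "w 0 \<in> {1..N}" "l (w 0) (\<pi> (shift w)) = \<pi> w"
proof -
  show *: "w 0 \<in> {1..N}" using assms by (simp add: code_space_def)
  show "l (w 0) (\<pi> (shift w)) = \<pi> w"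
    using coding_prepend[OF * shift_in_code_space[OF assms]] by simp
qed

text \<open>The first letter of a code of a point names a cell containing that point.\<close>

lemma self_similar_cover: "K = (\<Union>i\<in>{1..N}. l i ` K)"
proof (intro subset_antisym subsetI)
  fix x assume "x \<in> (\<Union>i\<in>{1..N}. l i ` K)"
  then show "x \<in> K" using l_in by blast
next
  fix x assume "x \<in> K"
  then obtain w where w: "w \<in> code_space N" "x = \<pi> w" by (rule coding_E)
  have "x = l (w 0) (\<pi> (shift w))" using coding_shift[OF w(1)] w(2) by simp
  moreover have "\<pi> (shift w) \<in> K" using w(1) by (intro coding_in shift_in_code_space)
  ultimately show "x \<in> (\<Union>i\<in>{1..N}. l i ` K)" using coding_shift(1)[OF w(1)] by blast
qed

lemma V0_subset: "V0 K N l \<pi> \<subseteq> K"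
  unfolding V0_def using post_critical_set_subset_code_space by (intro image_subsetI coding_in) blast

text \<open>Post-critical codes are closed under the shift, so deleting the first letter of a
  post-critical code of \<open>z\<close> gives a preimage of \<open>z\<close> that is again a
  boundary point.\<close>

lemma V0_E:
  assumes "z \<in> V0 K N l \<pi>"
  obtains i x where "i \<in> {1..N}" "x \<in> V0 K N l \<pi>" "z = l i x"
proof -
  obtain w where w: "w \<in> post_critical_set K N l \<pi>" "z = \<pi> w"
    using assms unfolding V0_def by (rule imageE)
  have wN: "w \<in> code_space N" using w(1) post_critical_set_subset_code_space by (rule rev_subsetD)
  have "\<pi> (shift w) \<in> V0 K N l \<pi>"
    unfolding V0_def by (intro imageI shift_in_post_critical_set w(1))
  then show ?thesis using that coding_shift[OF wN] w(2) by simp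
qed

lemma V0_subset_V_1: "V0 K N l \<pi> \<subseteq> V K N l \<pi> 1"
proof
  fix z assume "z \<in> V0 K N l \<pi>"
  then obtain i x where "i \<in> {1..N}" "x \<in> V0 K N l \<pi>" "z = l i x" by (rule V0_E)
  then show "z \<in> V K N l \<pi> 1" unfolding V_1 by blast
qed

text \<open>Putting the letter \<open>i\<close> in front of a code of \<open>x\<close> gives a code
  of a point in two different cells, which is critical by definition. One shift recovers the code of
  \<open>x\<close>, now as a post-critical one.\<close>

lemma cell_overlap_in_V0:
  assumes "i \<in> {1..N}" "j \<in> {1..N}" "i \<noteq> j" "x \<in> K" "y \<in> K" "l i x = l j y"
  shows "x \<in> V0 K N l \<pi>"
proof -
  obtain w where w: "w \<in> code_space N" "x = \<pi> w"
    using \<open>x \<in> K\<close> by (rule coding_E)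
  have "\<pi> (prepend i w) = l i x"
    using coding_prepend[OF assms(1) w(1)] w(2) by simp
  then have "\<pi> (prepend i w) \<in> l i ` K \<inter> l j ` K"
    using assms(4-6) by (metis IntI imageI)
  then have "prepend i w \<in> critical_set K N l \<pi>"
    using assms(1-3) prepend_in_code_space[OF assms(1) w(1)] unfolding critical_set_def by blast
  then have "(shift ^^ 1) (prepend i w) \<in> post_critical_set K N l \<pi>"
    unfolding post_critical_set_def by (intro UN_I[of 1] imageI) auto
  then show ?thesis using w(2) by (simp add: V0_def)
qed

text \<open>The point \<open>l i x\<close> has a preimage in \<open>V0\<close> under some
  \<open>l j\<close>. If \<open>j = i\<close>, injectivity identifies it with \<open>x\<close>;
  otherwise two cells meet and \<open>x\<close> is a boundary point anyway. Hence the maximum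
  argument can be run over \<open>V0\<close> alone.\<close>

lemma V0_backward:
  assumes "i \<in> {1..N}" "x \<in> K" "l i x \<in> V0 K N l \<pi>"
  shows "x \<in> V0 K N l \<pi>"
proof -
  obtain j y where y: "j \<in> {1..N}" "y \<in> V0 K N l \<pi>" "l i x = l j y"
    using assms(3) by (rule V0_E)
  have yK: "y \<in> K" using V0_subset y(2) by (rule subsetD)
  show ?thesis
  proof (cases "i = j")
    case True
    moreover have "inj_on (l i) K" using sss assms(1) by (simp add: self_similar_structure_def)
    ultimately have "x = y" using y(3) assms(2) yK by (simp add: inj_on_eq_iff)
    then show ?thesis using y(2) by simp
  next
    case False
    show ?thesis by (rule cell_overlap_in_V0[OF assms(1) y(1) False assms(2) yK y(3)])
  qed
qed

end

section \<open>Compactness: maximal distances and largest invariant sets\<close>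

lemma compact_no_maximal_dist_imp_eq:
  fixes D :: "('a::metric_space \<times> 'a) set"
  assumes "compact D"
    and "\<And>a b. (a, b) \<in> D \<Longrightarrow> a \<noteq> b \<Longrightarrow> \<exists>(c, d)\<in>D. dist a b < dist c d"
    and "(a, b) \<in> D"
  shows "a = b"
proof (rule ccontr)
  assume "a \<noteq> b"
  have "continuous_on D (\<lambda>z. dist (fst z) (snd z))" by (intro continuous_intros)
  then obtain z where z: "z \<in> D" "\<And>z'. z' \<in> D \<Longrightarrow> dist (fst z') (snd z') \<le> dist (fst z) (snd z)"
    using continuous_attains_sup[OF assms(1)] assms(3) by blast
  \<comment> \<open>The maximal distance is at least the positive number \<open>dist a b\<close>, so
    the maximizing pair is itself off the diagonal and the second assumption yields a pair farther
    apart.\<close>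
  have "dist a b \<le> dist (fst z) (snd z)" using z(2)[OF assms(3)] by simp
  then have "fst z \<noteq> snd z" using \<open>a \<noteq> b\<close> by auto
  then obtain c d where "(c, d) \<in> D" "dist (fst z) (snd z) < dist c d"
    using assms(2)[of "fst z" "snd z"] z(1) by auto
  then show False using z(2)[of "(c, d)"] by simp
qed

text \<open>The iterates of the Hutchinson operator on \<open>X\<close> decrease, and compactness
  lets preimages and fibres survive in their intersection. A set contained in its own image stays
  inside every iterate, by monotonicity. The map \<open>f\<close> plays the role of the projection
  onto the base.\<close>

lemma maximal_ifs_invariant_set:
  fixes X :: "'a::heine_borel set" and f :: "'a \<Rightarrow> 'b::t1_space"
  assumes X: "compact X"
    and WX: "\<And>n. n \<in> {1..N} \<Longrightarrow> W n \<in> X \<rightarrow> X"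
    and Wc: "\<And>n. n \<in> {1..N} \<Longrightarrow> continuous_on X (W n)"
    and f: "continuous_on X f"
    and proj: "\<And>n z. n \<in> {1..N} \<Longrightarrow> z \<in> X \<Longrightarrow> f (W n z) = l n (f z)"
    and cover: "f ` X = (\<Union>n\<in>{1..N}. l n ` f ` X)"
  obtains A where "compact A" "ifs_invariant X N W A" "f ` A = f ` X"
    "\<And>S. S \<subseteq> X \<Longrightarrow> S \<subseteq> (\<Union>n\<in>{1..N}. W n ` S) \<Longrightarrow> S \<subseteq> A"
proof -
  define T where "T A = (\<Union>n\<in>{1..N}. W n ` A)" for A
  define B where "B k = (T ^^ k) X" for k :: nat
  have T_mono: "S \<subseteq> S' \<Longrightarrow> T S \<subseteq> T S'" for S S' by (auto simp: T_def)
  have B0: "B 0 = X" and BSuc: "B (Suc k) = T (B k)" for k by (simp_all add: B_def)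
  have TX: "T X \<subseteq> X" using funcset_image[OF WX] unfolding T_def by blast
  have dec1: "B (Suc k) \<subseteq> B k" for k
  proof (induction k)
    case 0 show ?case using TX by (simp add: B0 BSuc)
  next
    case (Suc k) then show ?case using T_mono by (simp only: BSuc)
  qed
  have dec: "m \<le> k \<Longrightarrow> B k \<subseteq> B m" for m k
    using dec1 by (rule lift_Suc_antimono_le)
  have BX: "B k \<subseteq> X" for k using dec[of 0 k] B0 by simp
  have Bc: "compact (B k)" for k
  proof (induction k)
    case 0 show ?case using X by (simp add: B0)
  next
    case (Suc k)
    show ?case unfolding BSuc T_def
      using Suc by (intro compact_UN compact_continuous_image continuous_on_subset[OF Wc BX]) simp_all
  qed
  have fB: "f ` B k = f ` X" for k
  proof (induction k)
    case 0 show ?case by (simp add: B0)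
  next
    case (Suc k)
    have "f ` B (Suc k) = (\<Union>n\<in>{1..N}. (\<lambda>z. f (W n z)) ` B k)"
      by (simp add: BSuc T_def image_UN image_image)
    also have "\<dots> = (\<Union>n\<in>{1..N}. l n ` f ` B k)"
      using proj BX[of k] unfolding image_image by (intro SUP_cong image_cong refl) blast
    also have "\<dots> = f ` X" unfolding Suc by (rule cover[symmetric])
    finally show ?case .
  qed
  define A where "A = (\<Inter>k. B k)"
  \<comment> \<open>Cantor's intersection theorem for the compact level sets of \<open>g\<close> in
    the iterates. It serves twice: with \<open>g = W n\<close> to find preimages in
    \<open>A\<close>, and with \<open>g = f\<close> to find points of \<open>A\<close> over a given
    base point.\<close>
  have meet: "\<exists>z\<in>A. z \<in> X \<and> g z = c"
    if g: "continuous_on X g" and ex: "\<And>k. \<exists>z\<in>B k. g z = c" for g :: "'a \<Rightarrow> 'c::t1_space" and c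
  proof -
    have "closedin (top_of_set X) {z \<in> X. g z = c}"
      using continuous_closedin_preimage_constant[OF g] .
    then have "compact {z \<in> X. g z = c}"
      using X closedin_compact by blast
    then have *: "compact (B k \<inter> {z \<in> X. g z = c})" for k
      using Bc by (intro compact_Int)
    have "(\<Inter>k. B k \<inter> {z \<in> X. g z = c}) \<noteq> {}"
      by (rule compact_nest[OF *]) (use ex BX dec in blast)+
    then show ?thesis unfolding A_def by blast
  qed
  have AX: "A \<subseteq> X" using B0 by (auto simp: A_def)
  have Ac: "compact A" unfolding A_def
    using Bc by (intro compact_Inter) auto
  have TA: "T A \<subseteq> A"
  proof -
    have "T A \<subseteq> B k" for k
    proof (cases k)
      case 0 then show ?thesis using AX TX T_mono B0 by blast
    next
      case (Suc m)
      have "A \<subseteq> B m" by (auto simp: A_def)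
      then show ?thesis using T_mono by (simp add: Suc BSuc)
    qed
    then show ?thesis by (auto simp: A_def)
  qed
  have AT: "A \<subseteq> T A"
  proof
    fix a assume a: "a \<in> A"
    \<comment> \<open>A preimage of \<open>a\<close> exists in each \<open>B k\<close>, but under a
      map whose index may vary with \<open>k\<close>. By the pigeonhole principle one index
      \<open>n\<close> occurs for infinitely many \<open>k\<close>.\<close>
    have "\<exists>n. n \<in> {1..N} \<and> (\<exists>z\<in>B k. W n z = a)" for k
    proof -
      have "a \<in> B (Suc k)" using a unfolding A_def by blast
      then show ?thesis unfolding BSuc T_def by blast
    qed
    then obtain i where i: "\<And>k. i k \<in> {1..N}" "\<And>k. \<exists>z\<in>B k. W (i k) z = a"
      using choice[of "\<lambda>k n. n \<in> {1..N} \<and> (\<exists>z\<in>B k. W n z = a)"] by blast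
    have "finite (range i)" by (rule finite_subset[of _ "{1..N}"]) (simp_all add: i(1) image_subset_iff del: atLeastAtMost_iff One_nat_def)
    then obtain n where "n \<in> range i" and inf: "infinite (i -` {n})"
      using inf_img_fin_dom[OF _ infinite_UNIV_nat] by blast
    then have n: "n \<in> {1..N}" using i(1) by blast
    \<comment> \<open>Since the iterates decrease, a preimage under \<open>W n\<close> found at a
      later stage also lies in \<open>B k\<close>.\<close>
    have "\<exists>z\<in>B k. W n z = a" for k
    proof -
      obtain m where "m > k" "i m = n"
        using inf unfolding infinite_nat_iff_unbounded by blast
      moreover from this have "\<exists>z\<in>B m. W n z = a" using i(2)[of m] by simp
      ultimately show ?thesis using dec[of k m] by auto
    qed
    then obtain z where "z \<in> A" "W n z = a" using meet[OF Wc[OF n]] by blast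
    then show "a \<in> T A" using n by (auto simp: T_def)
  qed
  have inv: "ifs_invariant X N W A"
    unfolding ifs_invariant_def T_def[symmetric] using AX AT TA by (intro conjI subset_antisym)
  have fA: "f ` A = f ` X"
  proof
    show "f ` A \<subseteq> f ` X" using AX by (rule image_mono)
    show "f ` X \<subseteq> f ` A"
    proof
      fix c assume c: "c \<in> f ` X"
      have "\<exists>z\<in>B k. f z = c" for k
      proof -
        have "c \<in> f ` B k" using c by (simp only: fB)
        then show ?thesis by blast
      qed
      from meet[OF f this] show "c \<in> f ` A" by blast
    qed
  qed
  have max: "S \<subseteq> A" if S: "S \<subseteq> X" "S \<subseteq> T S" for S
  proof -
    have "S \<subseteq> B k" for k
    proof (induction k)
      case 0 show ?case using S(1) by (simp only: B0)
    next
      case (Suc k)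
      show ?case unfolding BSuc using S(2) T_mono[OF Suc] by (rule subset_trans)
    qed
    then show ?thesis by (auto simp: A_def)
  qed
  show thesis
    by (rule that[OF Ac inv fA]) (rule max, simp_all only: T_def)
qed

section \<open>The continuous invariant graph through prescribed data\<close>

theorem theorem3p1:
  fixes K :: "(real ^ 'd) set"
    and N L M :: nat
    and l :: "nat \<Rightarrow> real ^ 'd \<Rightarrow> real ^ 'd"
    and \<pi> :: "(nat \<Rightarrow> nat) \<Rightarrow> real ^ 'd"
    and H :: "real ^ 'd \<Rightarrow> real ^ 'd \<Rightarrow> real"
    and r :: "nat \<Rightarrow> real"
    and p t :: "nat \<Rightarrow> real ^ 'd"
    and J :: "real set"
    and u :: "real ^ 'd \<Rightarrow> real"
    and h :: "nat \<Rightarrow> real ^ 'd \<Rightarrow> real"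
    and s :: "nat \<Rightarrow> real \<Rightarrow> real"
    and F :: "nat \<Rightarrow> (real ^ 'd) \<times> real \<Rightarrow> real"
    and W :: "nat \<Rightarrow> (real ^ 'd) \<times> real \<Rightarrow> (real ^ 'd) \<times> real"
  assumes pcf: "pcf_self_similar_structure K N l \<pi>"
    and harm: "harmonic_structure K N l \<pi> H r"
    and p: "bij_betw p {1..L} (V0 K N l \<pi>)"
    and t: "bij_betw t {1..M} (V K N l \<pi> 1)"
    and tp: "\<forall>k\<in>{1..L}. t k = p k"
    and J: "compact J" "J \<noteq> {}"
    and u: "u \<in> V K N l \<pi> 1 \<rightarrow> J"
    and h: "\<forall>n\<in>{1..N}. harmonic_function K N l \<pi> H r (h n) \<and> \<not> h n constant_on K"
    and s: "\<forall>n\<in>{1..N}. edelstein_contraction J (s n)"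
    and F_eq: "\<forall>n\<in>{1..N}. \<forall>x\<in>K. \<forall>y\<in>J. F n (x, y) = h n x + s n y"
    and F_map: "\<forall>n\<in>{1..N}. F n \<in> K \<times> J \<rightarrow> J \<and> continuous_on (K \<times> J) (F n)"
    and compat: "\<forall>n\<in>{1..N}. \<forall>k\<in>{1..L}. h n (p k) + s n (u (p k)) = u (l n (p k))"
    and W: "\<forall>n\<in>{1..N}. \<forall>x\<in>K. \<forall>y\<in>J. W n (x, y) = (l n x, F n (x, y))"
  shows "\<exists>f \<in> K \<rightarrow>\<^sub>E J.
           continuous_on K f \<and> (\<forall>j\<in>{1..M}. f (t j) = u (t j)) \<and>
           ifs_invariant (K \<times> J) N W (graph_on K f) \<and>
           (\<forall>g \<in> K \<rightarrow>\<^sub>E J.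
              continuous_on K g \<and> (\<forall>j\<in>{1..M}. g (t j) = u (t j)) \<and>
              ifs_invariant (K \<times> J) N W (graph_on K g) \<longrightarrow> g = f) \<and>
           (\<forall>x\<in>V K N l \<pi> 1. f x = u x) \<and>
           (\<forall>n\<in>{1..N}. \<forall>x\<in>K. f (l n x) = s n (f x) + h n x) \<and>
           graph_on K f = (\<Union>n\<in>{1..N}. W n ` graph_on K f)"
proof -
  let ?V0 = "V0 K N l \<pi>"
  have sss: "self_similar_structure K N l \<pi>"
    using pcf by (simp add: pcf_self_similar_structure_def)
  have K: "compact K" and lK: "\<And>n. n \<in> {1..N} \<Longrightarrow> l n \<in> K \<rightarrow> K"
    and lc: "\<And>n. n \<in> {1..N} \<Longrightarrow> continuous_on K (l n)"
    and linj: "\<And>n. n \<in> {1..N} \<Longrightarrow> inj_on (l n) K"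
    using sss by (simp_all add: self_similar_structure_def)
  have W': "W n z = (l n (fst z), F n z)" if "n \<in> {1..N}" "z \<in> K \<times> J" for n z
    using W that by auto
  have WX: "W n \<in> K \<times> J \<rightarrow> K \<times> J" if "n \<in> {1..N}" for n
    using W'[OF that] lK[OF that] F_map that by (auto simp: Pi_iff)
  have Wc: "continuous_on (K \<times> J) (W n)" if n: "n \<in> {1..N}" for n
  proof -
    have "continuous_on (K \<times> J) (\<lambda>z. (l n (fst z), F n z))"
      using F_map n
      by (intro continuous_on_Pair continuous_on_compose2[OF lc[OF n]] continuous_intros) auto
    then show ?thesis using W'[OF n] by (simp cong: continuous_on_cong)
  qed
  \<comment> \<open>Nonemptiness of \<open>J\<close> makes the projection of
    \<open>K \<times> J\<close> all of \<open>K\<close>, so \<open>A\<close> will have a point over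
    every \<open>x\<close> in \<open>K\<close>.\<close>
  have fstX: "fst ` (K \<times> J) = K" using J(2) by simp
  obtain A where A: "compact A" "ifs_invariant (K \<times> J) N W A" "fst ` A = fst ` (K \<times> J)"
    and A_max: "\<And>S. S \<subseteq> K \<times> J \<Longrightarrow> S \<subseteq> (\<Union>n\<in>{1..N}. W n ` S) \<Longrightarrow> S \<subseteq> A"
  proof (rule maximal_ifs_invariant_set[of "K \<times> J" N W fst l])
    show "compact (K \<times> J)" using K J(1) by (rule compact_Times)
    show "fst ` (K \<times> J) = (\<Union>n\<in>{1..N}. l n ` fst ` (K \<times> J))"
      unfolding fstX by (rule self_similar_cover[OF sss])
  qed (use WX Wc W' in \<open>auto intro!: continuous_intros\<close>)
  have AX: "A \<subseteq> K \<times> J" and A_eq: "A = (\<Union>n\<in>{1..N}. W n ` A)"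
    using A(2) unfolding ifs_invariant_def by blast+
  have A_step: "(l n x, h n x + s n y) \<in> A" if "n \<in> {1..N}" "(x, y) \<in> A" for n x y
  proof -
    have "W n (x, y) = (l n x, h n x + s n y)" using that AX W F_eq by auto
    then show ?thesis using equalityD2[OF A_eq] that by (metis UN_I imageI subsetD)
  qed
  have A_E: "\<exists>n\<in>{1..N}. \<exists>x\<in>K. \<exists>\<eta>\<in>J. (x, \<eta>) \<in> A \<and> z = l n x \<and> y = h n x + s n \<eta>"
    if zy: "(z, y) \<in> A" for z y
  proof -
    obtain n x \<eta> where "n \<in> {1..N}" "(x, \<eta>) \<in> A" "(z, y) = W n (x, \<eta>)"
      using subsetD[OF equalityD1[OF A_eq] zy] by auto
    moreover from this have "x \<in> K" "\<eta> \<in> J" using AX by auto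
    moreover from calculation have "z = l n x" "y = h n x + s n \<eta>" using W F_eq by auto
    ultimately show ?thesis by blast
  qed
  \<comment> \<open>For fixed \<open>x\<close> the harmonic term cancels in the distance, leaving
    the strict contraction \<open>s n\<close>. The premise speaks of distinct images, because that
    is what is known when a deviating pair is pulled back.\<close>
  have s_less: "dist (h n x + s n y) (h n x + s n y') < dist y y'"
    if "n \<in> {1..N}" "y \<in> J" "y' \<in> J" "h n x + s n y \<noteq> h n x + s n y'" for n x y y'
  proof -
    have "y \<noteq> y'" using that(4) by auto
    then have "dist (s n y) (s n y') < dist y y'"
      using s that(1-3) unfolding edelstein_contraction_def by blast
    then show ?thesis by (simp add: dist_real_def)
  qed

  \<comment> \<open>Fibres of the invariant set\<close>
  have uJ: "u x \<in> J" if "x \<in> ?V0" for x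
    using u V0_subset_V_1[OF sss] that by auto
  have compat': "u (l n x) = h n x + s n (u x)" if "n \<in> {1..N}" "x \<in> ?V0" for n x
  proof -
    have "x \<in> p ` {1..L}" using p that(2) by (simp add: bij_betw_def)
    then show ?thesis using compat that(1) by auto
  qed
  have on_V0: "y = u x" if "(x, y) \<in> A" "x \<in> ?V0" for x y
  proof (rule compact_no_maximal_dist_imp_eq)
    \<comment> \<open>The pairs consist of a fibre value over a boundary point and the value of
      \<open>u\<close> there; finiteness of \<open>V0\<close> makes their set compact.\<close>
    let ?D = "\<Union>x\<in>?V0. (\<lambda>z. (snd z, u x)) ` (A \<inter> {x} \<times> UNIV)"
    have "finite ?V0" using bij_betw_finite[OF p] by simp
    moreover have "compact (A \<inter> {x} \<times> UNIV)" for x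
      using A(1) by (intro compact_Int_closed closed_Times) auto
    ultimately show "compact ?D"
      by (intro compact_UN compact_continuous_image continuous_intros) auto
    show "(y, u x) \<in> ?D" using that by force
    fix a b assume "(a, b) \<in> ?D" and ab: "a \<noteq> b"
    then obtain z where z: "z \<in> ?V0" "(z, a) \<in> A" "b = u z" by auto
    obtain n x' \<eta> where n: "n \<in> {1..N}" "x' \<in> K" "\<eta> \<in> J" "(x', \<eta>) \<in> A" "z = l n x'"
      "a = h n x' + s n \<eta>"
      using A_E[OF z(2)] by blast
    have x': "x' \<in> ?V0" using V0_backward[OF sss] n z by blast
    \<comment> \<open>The matching condition writes \<open>u z\<close> as
      \<open>h n x' + s n (u x')\<close>, so \<open>a\<close> and \<open>b\<close> are images of
      \<open>\<eta>\<close> and \<open>u x'\<close> under the same vertical map.\<close>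
    have "dist a b < dist \<eta> (u x')"
      using s_less[OF n(1,3) uJ[OF x'], of x'] compat'[OF n(1) x'] n z ab by simp
    moreover have "(\<eta>, u x') \<in> ?D" using n(4) x' by force
    ultimately show "\<exists>(c, d)\<in>?D. dist a b < dist c d" by blast
  qed
  have single: "y = y'" if "(x, y) \<in> A" "(x, y') \<in> A" for x y y'
  proof (rule compact_no_maximal_dist_imp_eq)
    \<comment> \<open>\<open>?E\<close> collects pairs of points of \<open>A\<close> with the same
      base point, and \<open>?D\<close> keeps their vertical coordinates.\<close>
    let ?E = "(A \<times> A) \<inter> {q. fst (fst q) = fst (snd q)}"
    let ?D = "(\<lambda>q. (snd (fst q), snd (snd q))) ` ?E"
    have D_I: "(a, b) \<in> ?D" if "(z, a) \<in> A" "(z, b) \<in> A" for z a b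
      using that by (intro image_eqI[of _ _ "((z, a), (z, b))"]) auto
    have "closed {q :: ((real^'d) \<times> real) \<times> ((real^'d) \<times> real). fst (fst q) = fst (snd q)}"
      by (intro closed_Collect_eq continuous_intros)
    then have "compact ?E" using A(1) by (intro compact_Int_closed compact_Times)
    then show "compact ?D" by (intro compact_continuous_image continuous_intros)
    show "(y, y') \<in> ?D" using that by (rule D_I)
    fix a b assume "(a, b) \<in> ?D" and ab: "a \<noteq> b"
    then obtain z where z: "(z, a) \<in> A" "(z, b) \<in> A" by auto
    obtain n v \<eta> where n: "n \<in> {1..N}" "v \<in> K" "\<eta> \<in> J" "(v, \<eta>) \<in> A" "z = l n v"
      "a = h n v + s n \<eta>"
      using A_E[OF z(1)] by blast
    obtain m w \<theta> where m: "m \<in> {1..N}" "w \<in> K" "\<theta> \<in> J" "(w, \<theta>) \<in> A" "z = l m w"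
      "b = h m w + s m \<theta>"
      using A_E[OF z(2)] by blast
    have "n = m"
    proof (rule ccontr)
      assume nm: "n \<noteq> m"
      \<comment> \<open>Different letters would mean that two cells meet at \<open>z\<close>. Both
        preimages are then boundary points, where the fibres are already known, and matching forces
        \<open>a\<close> and \<open>b\<close> to equal \<open>u z\<close>.\<close>
      have v: "v \<in> ?V0" and w: "w \<in> ?V0"
        using cell_overlap_in_V0[OF sss] n m nm by metis+
      have "a = u z" using n(5,6) compat'[OF n(1) v] on_V0[OF n(4) v] by simp
      moreover have "b = u z" using m(5,6) compat'[OF m(1) w] on_V0[OF m(4) w] by simp
      ultimately show False using ab by simp
    qed
    \<comment> \<open>With a common letter, injectivity gives a common base point, so the
      pulled-back pair lies in one fibre.\<close>
    then have "l n v = l n w" using n(5) m(5) by simp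
    then have "v = w" using linj[OF n(1)] n(2) m(2) by (simp add: inj_on_eq_iff)
    have "dist a b < dist \<eta> \<theta>"
      using s_less[OF n(1,3) m(3), of v] n m ab \<open>n = m\<close> \<open>v = w\<close> by simp
    moreover have "(\<eta>, \<theta>) \<in> ?D" using n m \<open>v = w\<close> D_I by blast
    ultimately show "\<exists>(c, d)\<in>?D. dist a b < dist c d" by blast
  qed

  \<comment> \<open>The function whose graph is the invariant set\<close>
  have "\<exists>y. (x, y) \<in> A" if "x \<in> K" for x
  proof -
    have "x \<in> fst ` A" using A(3) fstX that by simp
    then show ?thesis by force
  qed
  then obtain f0 where f0: "\<And>x. x \<in> K \<Longrightarrow> (x, f0 x) \<in> A" by metis
  \<comment> \<open>Fixing the value \<open>undefined\<close> outside \<open>K\<close> puts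
    \<open>f\<close> into \<open>K \<rightarrow>\<^sub>E J\<close> and makes uniqueness an equality
    of functions.\<close>
  define f where "f = restrict f0 K"
  have f: "(x, f x) \<in> A" if "x \<in> K" for x using f0 that by (simp add: f_def)
  have fJ: "f \<in> K \<rightarrow>\<^sub>E J" using f0 AX by (auto simp: f_def)
  have graph: "graph_on K f = A"
  proof
    show "graph_on K f \<subseteq> A" using f by (auto simp: graph_on_def)
    show "A \<subseteq> graph_on K f"
    proof
      fix q assume q: "q \<in> A"
      then have x: "fst q \<in> K" using AX by auto
      have "snd q = f (fst q)" using single[OF _ f[OF x]] q by simp
      then show "q \<in> graph_on K f" using x by (auto simp: graph_on_def prod_eq_iff)
    qed
  qed
  have cont: "continuous_on K f"
  proof -
    \<comment> \<open>Closed graph theorem: a map into the compact set \<open>J\<close> with closed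
      graph is continuous.\<close>
    have "(\<lambda>x. (x, f x)) ` K = A" unfolding graph[symmetric] graph_on_def by blast
    moreover have "closedin (top_of_set (K \<times> J)) A"
      using A(1) AX by (simp add: closed_subset compact_imp_closed)
    ultimately show ?thesis
      using continuous_closed_graph_eq[OF J(1), of f K] fJ by auto
  qed
  have eq: "f (l n x) = s n (f x) + h n x" if "n \<in> {1..N}" "x \<in> K" for n x
  proof -
    have "l n x \<in> K" using lK that by blast
    \<comment> \<open>Both sides are vertical coordinates of points of \<open>A\<close> over
      \<open>l n x\<close>, and fibres are singletons.\<close>
    then show ?thesis using single[OF f A_step[OF that(1) f[OF that(2)]]] by simp
  qed
  have on_V1: "f x = u x" if x: "x \<in> V K N l \<pi> 1" for x
  proof -
    obtain n z where n: "n \<in> {1..N}" "z \<in> ?V0" "x = l n z" using x unfolding V_1 by blast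
    have z: "z \<in> K" using n(2) V0_subset[OF sss] by blast
    show ?thesis using n(3) eq[OF n(1) z] on_V0[OF f[OF z] n(2)] compat'[OF n(1,2)] by simp
  qed
  have uniq: "g = f" if g: "g \<in> K \<rightarrow>\<^sub>E J" "ifs_invariant (K \<times> J) N W (graph_on K g)" for g
  proof (rule extensionalityI)
    \<comment> \<open>An invariant graph lies in the largest invariant set, whose fibres are the
      single values of \<open>f\<close>.\<close>
    have "graph_on K g \<subseteq> A"
      using g(2) unfolding ifs_invariant_def by (intro A_max) blast+
    then have "(x, g x) \<in> A" if "x \<in> K" for x using that unfolding graph_on_def by blast
    then show "g x = f x" if "x \<in> K" for x using that single f by blast
    show "g \<in> extensional K" "f \<in> extensional K" using g(1) fJ by (simp_all add: PiE_def)
  qed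
  show ?thesis
  proof (intro bexI[OF _ fJ] conjI ballI impI)
    show "continuous_on K f" by (rule cont)
    show "f (t j) = u (t j)" if "j \<in> {1..M}" for j
      using on_V1 bij_betw_apply[OF t that] .
    show "ifs_invariant (K \<times> J) N W (graph_on K f)"
      unfolding graph by (rule A(2))
    show "g = f"
      if "g \<in> K \<rightarrow>\<^sub>E J" "continuous_on K g \<and> (\<forall>j\<in>{1..M}. g (t j) = u (t j)) \<and>
        ifs_invariant (K \<times> J) N W (graph_on K g)" for g
      using that by (intro uniq) simp_all
    show "f x = u x" if "x \<in> V K N l \<pi> 1" for x
      using that by (rule on_V1)
    show "f (l n x) = s n (f x) + h n x" if "n \<in> {1..N}" "x \<in> K" for n x
      using that by (rule eq)
    show "graph_on K f = (\<Union>n\<in>{1..N}. W n ` graph_on K f)"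
      unfolding graph by (rule A_eq)
  qed
qed

end
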